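(* There exists a heavy-tailed $K$-armed bandit instance with $(1+v)$-th raw moment bound $u\le 1$ (that is, $\mathbb E_{X\sim\mathcal X_a}[|X|^{1+v}]\le u\le1$ for every arm $a$), $\mu_a\le\frac16$ and $\Delta_a\in(0,\frac1{12})$ (for the sub-optimal arms $a$), such that for any $\epsilon$-differentially private algorithm $\mathcal A$ (with $0<\epsilon\le1$) whose expected regret is at most $T^{\frac34}$, we have $$\mathcal R_T\ge\Omega\left(\frac{\log T}{\epsilon}\sum_{\Delta_a>0}\Bigl(\frac1{\Delta_a}\Bigr)^{\frac1v}\right).$$
   Context: Bandit setting. There are $K$ arms and $T$ rounds. Pulling arm $a$ yields an independent reward from a distribution $\mathcal X_a$ on $\mathbb R$ with mean $\mu_a$. In each round $t=1,\dots,T$ the learner pulls an arm $a_t\in[K]$ and observes a reward $x_t\sim\mathcal X_{a_t}$. Let $\mu^*=\max_a\mu_a$ and $\Delta_a=\mu^*-\mu_a$. The expected regret is $\mathcal R_T=T\mu^*-\mathbb E[\sum_{t=1}^Tx_t]$. Heavy-tailed means that, for some $v\in(0,1]$ and $u>0$, $\mathbb E_{X\sim\mathcal X_a}[|X|^{1+v}]\le u$ for every arm $a$. Both $v$ and $u$ are regarded as known constants (for any constant $c$, $c^{1/v}$ is regarded as a constant), and $\Omega(\cdot)$ hides constant factors. Differential privacy (event level). Two data (reward) streams are adjacent if they differ at exactly one time step. An algorithm $\mathcal M$ is $\epsilon$-differentially private if for any adjacent streams $\sigma,\sigma'$ and any measurable subset $O$ of the output space of $\mathcal M$, $\mathbb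 P[\mathcal M(\sigma)\in O]\le e^{\epsilon}\,\mathbb P[\mathcal M(\sigma')\in O]$. *)

theory Defs
  imports "HOL-Probability.Probability"
begin

text \<open>
  Arms are \<open>{..<K}\<close> and rounds are \<open>{..<T}\<close>, both counted from 0. A bandit instance assigns a
  reward law to every arm; its values outside \<open>{..<K}\<close> play no role.
\<close>

type_synonym bandit = "nat \<Rightarrow> real measure"

definition arm_mean :: "bandit \<Rightarrow> nat \<Rightarrow> real" where
  "arm_mean X a = (\<integral>x. x \<partial>X a)"

definition best_mean :: "nat \<Rightarrow> bandit \<Rightarrow> real" where
  "best_mean K X = Max (arm_mean X ` {..<K})"

definition gap :: "nat \<Rightarrow> bandit \<Rightarrow> nat \<Rightarrow> real" where
  "gap K X a = best_mean K X - arm_mean X a"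

definition heavy_tailed_bandit :: "nat \<Rightarrow> real \<Rightarrow> real \<Rightarrow> bandit \<Rightarrow> bool" where
  "heavy_tailed_bandit K v u X \<longleftrightarrow>
     (\<forall>a<K. prob_space (X a) \<and> sets (X a) = sets borel \<and>
            integrable (X a) (\<lambda>x. \<bar>x\<bar> powr (1 + v)) \<and>
            (\<integral>x. \<bar>x\<bar> powr (1 + v) \<partial>X a) \<le> u)"

text \<open>
  The history before round \<open>t\<close> is the family of pairs (arm, reward) of the rounds \<open>{..<t}\<close>. A
  randomized algorithm is a sequence of Markov kernels from histories to arms.
\<close>

type_synonym history = "nat \<Rightarrow> nat \<times> real"
type_synonym algorithm = "nat \<Rightarrow> history \<Rightarrow> nat measure"

definition history_space :: "nat \<Rightarrow> nat \<Rightarrow> history measure" where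
  "history_space K t = (\<Pi>\<^sub>M s\<in>{..<t}. count_space {..<K} \<Otimes>\<^sub>M borel)"

definition bandit_algorithm :: "nat \<Rightarrow> nat \<Rightarrow> algorithm \<Rightarrow> bool" where
  "bandit_algorithm K T A \<longleftrightarrow>
     (\<forall>t<T. A t \<in> history_space K t \<rightarrow>\<^sub>M prob_algebra (count_space {..<K}))"

text \<open>
  The law of the history after \<open>t\<close> rounds, when pulling arm \<open>a\<close> in round \<open>t\<close> is answered by a
  fresh reward of law \<open>\<rho> t a\<close>. It is used both with the reward laws of a bandit and with a
  deterministic reward stream.
\<close>

primrec interaction ::
  "nat \<Rightarrow> algorithm \<Rightarrow> (nat \<Rightarrow> nat \<Rightarrow> real measure) \<Rightarrow> nat \<Rightarrow> history measure" where
  "interaction K A \<rho> 0 = return (history_space K 0) (\<lambda>_. undefined)"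
| "interaction K A \<rho> (Suc t) =
     interaction K A \<rho> t \<bind> (\<lambda>h. A t h \<bind> (\<lambda>a. \<rho> t a \<bind> (\<lambda>x.
       return (history_space K (Suc t)) (h(t := (a, x))))))"

definition regret :: "nat \<Rightarrow> nat \<Rightarrow> algorithm \<Rightarrow> bandit \<Rightarrow> real" where
  "regret K T A X =
     real T * best_mean K X - (\<integral>h. (\<Sum>t<T. snd (h t)) \<partial>interaction K A (\<lambda>_. X) T)"

text \<open>
  A reward stream \<open>\<sigma>\<close> answers the pull of round \<open>t\<close> by \<open>\<sigma> t\<close>; only the entries in \<open>{..<T}\<close>
  count. The output of the algorithm on \<open>\<sigma>\<close> is the sequence of the arms it pulls. For pure
  differential privacy it makes no difference whether a stream carries one reward per round, as
  here, or a vector with one reward per arm and round: the probability of an action sequence only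
  involves the entries at the pulled arms, so the two requirements agree on every single action
  sequence, and hence on every set of them.
\<close>

definition action_space :: "nat \<Rightarrow> nat \<Rightarrow> (nat \<Rightarrow> nat) measure" where
  "action_space K T = (\<Pi>\<^sub>M t\<in>{..<T}. count_space {..<K})"

definition algorithm_output :: "nat \<Rightarrow> nat \<Rightarrow> algorithm \<Rightarrow> (nat \<Rightarrow> real) \<Rightarrow> (nat \<Rightarrow> nat) measure" where
  "algorithm_output K T A \<sigma> =
     distr (interaction K A (\<lambda>t _. return borel (\<sigma> t)) T) (action_space K T)
       (\<lambda>h. \<lambda>t\<in>{..<T}. fst (h t))"

definition adjacent :: "nat \<Rightarrow> (nat \<Rightarrow> real) \<Rightarrow> (nat \<Rightarrow> real) \<Rightarrow> bool" where
  "adjacent T \<sigma> \<sigma>' \<longleftrightarrow> (\<exists>!t. t < T \<and> \<sigma> t \<noteq> \<sigma>' t)"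

definition differentially_private :: "nat \<Rightarrow> nat \<Rightarrow> real \<Rightarrow> algorithm \<Rightarrow> bool" where
  "differentially_private K T \<epsilon> A \<longleftrightarrow>
     (\<forall>\<sigma> \<sigma>'. adjacent T \<sigma> \<sigma>' \<longrightarrow> (\<forall>S\<in>sets (action_space K T).
        measure (algorithm_output K T A \<sigma>) S
          \<le> exp \<epsilon> * measure (algorithm_output K T A \<sigma>') S))"

text \<open>
  ``Expected regret at most \<open>T powr (3/4)\<close>'' has to be a property of the algorithm over the whole
  class of heavy-tailed bandits: on a single instance, always pulling the best arm has regret 0.
  The threshold \<open>N Y\<close> is the horizon from which on the guarantee is required on \<open>Y\<close>. The choice
  \<open>N = (\<lambda>_. 0)\<close> is the uniform guarantee, which for \<open>v < 1/3\<close> and large horizons no algorithm has,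
  as the minimax regret is of order \<open>T powr (1 / (1 + v))\<close>; a guarantee with instance-dependent
  thresholds is meaningful for all \<open>v\<close>.
\<close>

definition regret_guarantee ::
  "nat \<Rightarrow> real \<Rightarrow> real \<Rightarrow> (bandit \<Rightarrow> nat) \<Rightarrow> nat \<Rightarrow> algorithm \<Rightarrow> bool" where
  "regret_guarantee K v u N T A \<longleftrightarrow>
     (\<forall>Y. heavy_tailed_bandit K v u Y \<and> N Y \<le> T \<longrightarrow> regret K T A Y \<le> real T powr (3/4))"

text \<open>
  Gap profiles with all positive gaps in \<open>(0, 1/12)\<close>. Moment bound \<open>u\<close> confines all means to
  \<open>[- (u powr (1/(1+v))), u powr (1/(1+v))]\<close>, so for small \<open>u\<close> not all of these are realizable;
  this is the purpose of the condition \<open>\<delta> a \<le> u / 4\<close>, which is redundant for \<open>u \<ge> 1/3\<close>.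
\<close>

definition gap_profile :: "nat \<Rightarrow> real \<Rightarrow> (nat \<Rightarrow> real) \<Rightarrow> bool" where
  "gap_profile K u \<delta> \<longleftrightarrow>
     (\<exists>a<K. \<delta> a = 0) \<and> (\<forall>a<K. \<delta> a = 0 \<or> \<delta> a \<in> {0<..<1/12} \<and> \<delta> a \<le> u / 4)"

end

theory Submission
  imports Defs
begin

text \<open>
  The hard instance is deterministic: arm \<open>a\<close> always pays \<open>- \<delta> a\<close>. For a suboptimal arm \<open>a\<close> with
  gap \<open>d\<close>, the competing instance lets arm \<open>a\<close> pay a rare large reward \<open>M\<close> with probability \<open>\<beta>\<close>,
  where \<open>\<beta> M = 2 d\<close> makes it the best arm by a margin \<open>d\<close> and \<open>M powr v = 3 u / (8 d)\<close> keeps the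
  moment below \<open>u\<close>; thus \<open>\<beta>\<close> is of order \<open>d powr (1 + 1 / v)\<close>. Group privacy, averaged over the
  independent spikes, shows that an action sequence with \<open>n\<close> pulls of \<open>a\<close> loses at most the factor
  \<open>(1 - \<beta> (1 - exp (- \<epsilon>))) ^ n \<ge> exp (- 2 \<beta> \<epsilon> n)\<close> of its probability in the competing instance.
  If \<open>a\<close> were pulled fewer than \<open>ln T / (32 \<beta> \<epsilon>)\<close> times on average in the hard instance, then by
  Markov's inequality it would be neglected with probability of order \<open>T powr (-1/8)\<close> in the
  competing one, whose regret would then be of order \<open>d * T powr (7/8)\<close>.
\<close>

section \<open>Interaction with finitely supported reward laws\<close>

lemma sum_PiE_lessThan_Suc:
  "(\<Sum>w\<in>PiE {..<Suc t} (\<lambda>_. B). G w) =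
   (\<Sum>w\<in>PiE {..<t} (\<lambda>_. B). \<Sum>b\<in>B. G (w(t := b)))"
proof -
  have "(\<Sum>w\<in>PiE {..<Suc t} (\<lambda>_. B). G w) =
    sum G ((\<lambda>(b, w). w(t := b)) ` (B \<times> PiE {..<t} (\<lambda>_. B)))"
    by (simp add: lessThan_Suc PiE_insert_eq)
  also have "\<dots> = (\<Sum>(b, w)\<in>B \<times> PiE {..<t} (\<lambda>_. B). G (w(t := b)))"
    using inj_combinator[of t "{..<t}" "\<lambda>_. B"]
    by (subst sum.reindex) (auto simp: case_prod_unfold)
  also have "\<dots> = (\<Sum>w\<in>PiE {..<t} (\<lambda>_. B). \<Sum>b\<in>B. G (w(t := b)))"
    by (subst sum.swap) (simp add: sum.cartesian_product)
  finally show ?thesis .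
qed

lemma nn_integral_finite_space:
  assumes "sets M = Pow S" "finite S"
  shows "(\<integral>\<^sup>+x. g x \<partial>M) = (\<Sum>a\<in>S. g a * emeasure M {a})"
proof -
  have sp: "space M = S"
    using sets_eq_imp_space_eq[of M "count_space S"] assms by simp
  have "(\<integral>\<^sup>+x. g x \<partial>M) = (\<integral>\<^sup>+x. (\<Sum>a\<in>S. g a * indicator {a} x) \<partial>M)"
    by (intro nn_integral_cong)
       (simp add: sp assms indicator_def of_bool_def if_distrib[of "(*) _"] cong: if_cong)
  also have "\<dots> = (\<Sum>a\<in>S. \<integral>\<^sup>+x. g a * indicator {a} x \<partial>M)"
    by (intro nn_integral_sum borel_measurable_times_ennreal borel_measurable_indicator)
       (auto simp: assms)
  also have "\<dots> = (\<Sum>a\<in>S. g a * emeasure M {a})"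
    by (intro sum.cong refl nn_integral_cmult_indicator) (auto simp: assms)
  finally show ?thesis .
qed

text \<open>The identity pushforward only coarsens the sigma-algebra of the pmf to the Borel sets
  that \<open>heavy_tailed_bandit\<close> and the history space work with. Point masses give the
  rewards of a deterministic stream, so bandits and streams share one calculus of finite
  sums.\<close>

definition borel_law :: "real pmf \<Rightarrow> real measure" where
  "borel_law p = distr (measure_pmf p) borel (\<lambda>x. x)"

lemma sets_borel_law [simp, measurable_cong]: "sets (borel_law p) = sets borel"
  by (simp add: borel_law_def)

lemma prob_space_borel_law: "prob_space (borel_law p)"
  unfolding borel_law_def by (intro measure_pmf.prob_space_distr) simp

lemma borel_law_return_pmf: "borel_law (return_pmf x) = return borel x"
  by (intro measure_eqI) (auto simp: borel_law_def emeasure_distr)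

lemma integral_borel_law:
  fixes f :: "real \<Rightarrow> real"
  assumes "f \<in> borel_measurable borel"
  shows "(\<integral>x. f x \<partial>borel_law p) = (\<integral>x. f x \<partial>measure_pmf p)"
  using assms by (simp add: borel_law_def integral_distr)

lemma arm_mean_borel_law: "arm_mean (\<lambda>a. borel_law (p a)) a = measure_pmf.expectation (p a) (\<lambda>x. x)"
  by (simp add: arm_mean_def integral_borel_law)

lemma integrable_borel_law:
  fixes f :: "real \<Rightarrow> real"
  assumes "f \<in> borel_measurable borel" "finite (set_pmf p)"
  shows "integrable (borel_law p) f"
  using assms by (simp add: borel_law_def integrable_distr_eq integrable_measure_pmf_finite)

section \<open>Transcripts, likelihoods and path weights\<close>

definition transcript :: "(nat \<Rightarrow> nat) \<Rightarrow> (nat \<Rightarrow> real) \<Rightarrow> nat \<Rightarrow> history" where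
  "transcript w \<sigma> t = (\<lambda>s\<in>{..<t}. (w s, \<sigma> s))"

text \<open>Only the randomness of the algorithm enters here. Keeping it apart from the reward
  probabilities lets the rewards vary while the actions stay fixed, which is the comparison that
  privacy controls.\<close>

definition likelihood :: "algorithm \<Rightarrow> (nat \<Rightarrow> nat) \<Rightarrow> (nat \<Rightarrow> real) \<Rightarrow> nat \<Rightarrow> real" where
  "likelihood A w \<sigma> t = (\<Prod>s<t. measure (A s (transcript w \<sigma> s)) {w s})"

text \<open>The laws carry a round and an arm so that one formula covers both uses of
  \<open>interaction\<close>: a bandit depends on the arm only, a reward stream on the round
  only.\<close>

definition path_weight ::
  "algorithm \<Rightarrow> (nat \<Rightarrow> nat \<Rightarrow> real pmf) \<Rightarrow> (nat \<Rightarrow> nat) \<Rightarrow> (nat \<Rightarrow> real) \<Rightarrow> nat \<Rightarrow> real" where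
  "path_weight A p w \<sigma> t = likelihood A w \<sigma> t * (\<Prod>s<t. pmf (p s (w s)) (\<sigma> s))"

lemma likelihood_nonneg: "0 \<le> likelihood A w \<sigma> t"
  by (simp add: likelihood_def prod_nonneg)

lemma path_weight_nonneg: "0 \<le> path_weight A p w \<sigma> t"
  by (simp add: path_weight_def likelihood_nonneg prod_nonneg)

lemma transcript_cong:
  "(\<And>s. s < t \<Longrightarrow> w s = w' s) \<Longrightarrow> (\<And>s. s < t \<Longrightarrow> \<sigma> s = \<sigma>' s) \<Longrightarrow>
   transcript w \<sigma> t = transcript w' \<sigma>' t"
  by (auto simp: transcript_def restrict_def)

lemma likelihood_cong:
  assumes "\<And>s. s < t \<Longrightarrow> w s = w' s" "\<And>s. s < t \<Longrightarrow> \<sigma> s = \<sigma>' s"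
  shows "likelihood A w \<sigma> t = likelihood A w' \<sigma>' t"
proof -
  have "transcript w \<sigma> s = transcript w' \<sigma>' s" if "s < t" for s
    using that assms by (intro transcript_cong) auto
  then show ?thesis
    using assms by (simp add: likelihood_def)
qed

lemma transcript_Suc:
  "transcript (w(t := a)) (\<sigma>(t := r)) (Suc t) = (transcript w \<sigma> t)(t := (a, r))"
  by (auto simp: transcript_def restrict_def fun_eq_iff)

lemma path_weight_Suc:
  "path_weight A p (w(t := a)) (\<sigma>(t := r)) (Suc t) =
   path_weight A p w \<sigma> t * (measure (A t (transcript w \<sigma> t)) {a} * pmf (p t a) r)"
proof -
  have "likelihood A (w(t := a)) (\<sigma>(t := r)) (Suc t) =
    likelihood A (w(t := a)) (\<sigma>(t := r)) t *
      measure (A t (transcript (w(t := a)) (\<sigma>(t := r)) t)) {a}"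
    by (simp add: likelihood_def)
  moreover have "likelihood A (w(t := a)) (\<sigma>(t := r)) t = likelihood A w \<sigma> t"
    by (intro likelihood_cong) auto
  moreover have "transcript (w(t := a)) (\<sigma>(t := r)) t = transcript w \<sigma> t"
    by (intro transcript_cong) auto
  ultimately show ?thesis
    by (simp add: path_weight_def)
qed

section \<open>The law of the history as a finite weighted sum\<close>

lemma space_history_space:
  "space (history_space K t) = PiE {..<t} (\<lambda>_. {..<K} \<times> UNIV)"
  by (simp add: history_space_def space_PiM space_pair_measure)

lemma transcript_in_space:
  "w \<in> PiE {..<t} (\<lambda>_. {..<K}) \<Longrightarrow> transcript w \<sigma> t \<in> space (history_space K t)"
  by (auto simp: space_history_space transcript_def)

lemma measurable_history_upd:
  "(\<lambda>((h, a), x). h(t := (a, x)))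
     \<in> (history_space K t \<Otimes>\<^sub>M count_space {..<K}) \<Otimes>\<^sub>M borel \<rightarrow>\<^sub>M history_space K (Suc t)"
proof -
  have "(\<lambda>z. (fst (fst z))(t := (snd (fst z), snd z)))
     \<in> (history_space K t \<Otimes>\<^sub>M count_space {..<K}) \<Otimes>\<^sub>M borel \<rightarrow>\<^sub>M history_space K (Suc t)"
    unfolding history_space_def
    by (rule measurable_fun_upd[where J = "{..<t}"]) (auto simp: lessThan_Suc)
  then show ?thesis
    by (simp add: case_prod_unfold)
qed

definition interaction_step ::
  "nat \<Rightarrow> algorithm \<Rightarrow> (nat \<Rightarrow> nat \<Rightarrow> real pmf) \<Rightarrow> nat \<Rightarrow> history \<Rightarrow> history measure" where
  "interaction_step K A p t h = A t h \<bind> (\<lambda>a. borel_law (p t a) \<bind> (\<lambda>x.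
       return (history_space K (Suc t)) (h(t := (a, x)))))"

locale bandit_run =
  fixes K T :: nat and A :: algorithm
  assumes algorithm: "bandit_algorithm K T A"
begin

lemma measurable_algorithm:
  "t < T \<Longrightarrow> A t \<in> history_space K t \<rightarrow>\<^sub>M prob_algebra (count_space {..<K})"
  using algorithm by (simp add: bandit_algorithm_def)

lemma measurable_reward_step:
  "(\<lambda>(h, a). borel_law (p a) \<bind> (\<lambda>x. return (history_space K (Suc t)) (h(t := (a, x)))))
     \<in> history_space K t \<Otimes>\<^sub>M count_space {..<K} \<rightarrow>\<^sub>M prob_algebra (history_space K (Suc t))"
proof -
  have p: "(\<lambda>a. borel_law (p a)) \<in> count_space {..<K} \<rightarrow>\<^sub>M prob_algebra borel"
    by (auto simp: space_prob_algebra prob_space_borel_law)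
  have r: "(\<lambda>z. return (history_space K (Suc t)) ((\<lambda>((h, a), x). h(t := (a, x))) z))
    \<in> (history_space K t \<Otimes>\<^sub>M count_space {..<K}) \<Otimes>\<^sub>M borel
      \<rightarrow>\<^sub>M prob_algebra (history_space K (Suc t))"
    by (rule measurable_compose[OF measurable_history_upd measurable_return_prob_space])
  show ?thesis
    unfolding case_prod_unfold
    by (rule measurable_bind_prob_space2[where N = borel])
       (use r measurable_compose[OF measurable_snd p] in \<open>simp_all add: case_prod_unfold\<close>)
qed

lemma measurable_interaction_step:
  assumes "t < T"
  shows "interaction_step K A p t \<in> history_space K t \<rightarrow>\<^sub>M prob_algebra (history_space K (Suc t))"
  unfolding interaction_step_def [abs_def]
  by (rule measurable_bind_prob_space2[OF measurable_algorithm[OF assms] measurable_reward_step])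

lemma interaction_in_prob_algebra:
  assumes "t \<le> T"
  shows "interaction K A (\<lambda>s a. borel_law (p s a)) t \<in> space (prob_algebra (history_space K t))"
  using assms
proof (induction t)
  case 0
  have "(\<lambda>_. undefined) \<in> space (history_space K 0)"
    by (simp add: space_history_space)
  then show ?case
    using measurable_space[OF measurable_return_prob_space] by simp
next
  case (Suc t)
  \<comment> \<open>The law of the first \<open>t\<close> rounds is viewed as a constant kernel on a
    one-point space, so that the rule for composing Markov kernels applies.\<close>
  have "(\<lambda>_. interaction K A (\<lambda>s a. borel_law (p s a)) t \<bind> interaction_step K A p t)
     \<in> count_space {()} \<rightarrow>\<^sub>M prob_algebra (history_space K (Suc t))"
    by (rule measurable_bind_prob_space[OF measurable_const measurable_interaction_step])
       (use Suc in auto)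
  then show ?case
    by (auto simp: interaction_step_def[abs_def] dest: measurable_space)
qed

lemma nn_integral_interaction_step:
  assumes "t < T" "f \<in> borel_measurable (history_space K (Suc t))"
    and "h \<in> space (history_space K t)"
    and "finite R" "\<And>a. a < K \<Longrightarrow> set_pmf (p t a) \<subseteq> R"
  shows "(\<integral>\<^sup>+y. f y \<partial>interaction_step K A p t h) =
    (\<Sum>a<K. \<Sum>r\<in>R. ennreal (measure (A t h) {a} * pmf (p t a) r) * f (h(t := (a, r))))"
proof -
  let ?H = "history_space K (Suc t)"
  have Ah: "A t h \<in> space (prob_algebra (count_space {..<K}))"
    using measurable_space[OF measurable_algorithm[OF assms(1)] assms(3)] .
  then have sets_Ah: "sets (A t h) = Pow {..<K}" and "prob_space (A t h)"
    by (auto simp: space_prob_algebra)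
  then interpret Ah: prob_space "A t h" by simp
  have upd: "(\<lambda>x. h(t := (a, x))) \<in> borel \<rightarrow>\<^sub>M ?H" if "a < K" for a
    using measurable_compose[OF measurable_Pair1'[of "(h, a)" _ borel] measurable_history_upd[of t K]]
    using that assms(3) by (simp add: space_pair_measure)
  have inner: "(\<lambda>a. borel_law (p t a) \<bind> (\<lambda>x. return ?H (h(t := (a, x)))))
      \<in> count_space {..<K} \<rightarrow>\<^sub>M subprob_algebra ?H"
    using measurable_compose[OF measurable_Pair1' [OF assms(3)] measurable_reward_step]
    by (intro measurable_prob_algebraD) simp
  have sets_Ah': "sets (A t h) = sets (count_space {..<K})"
    using sets_Ah by simp
  note inner' = inner[folded measurable_cong_sets[OF sets_Ah' refl]]
  have reward: "(\<integral>\<^sup>+y. f y \<partial>(borel_law (p t a) \<bind> (\<lambda>x. return ?H (h(t := (a, x)))))) =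
      (\<Sum>r\<in>R. f (h(t := (a, r))) * pmf (p t a) r)" if "a < K" for a
  proof -
    have "(\<integral>\<^sup>+y. f y \<partial>(borel_law (p t a) \<bind> (\<lambda>x. return ?H (h(t := (a, x)))))) =
      (\<integral>\<^sup>+x. \<integral>\<^sup>+y. f y \<partial>return ?H (h(t := (a, x))) \<partial>borel_law (p t a))"
      using measurable_compose[OF upd[OF that] return_measurable]
      by (intro nn_integral_bind[OF assms(2)])
         (simp cong: measurable_cong_sets)
    also have "\<dots> = (\<integral>\<^sup>+x. f (h(t := (a, x))) \<partial>borel_law (p t a))"
      using measurable_space[OF upd[OF that]] assms(2)
      by (intro nn_integral_cong nn_integral_return) auto
    also have "\<dots> = (\<integral>\<^sup>+x. f (h(t := (a, x))) \<partial>measure_pmf (p t a))"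
      unfolding borel_law_def using measurable_compose[OF upd[OF that] assms(2)]
      by (subst nn_integral_distr) auto
    also have "\<dots> = (\<Sum>r\<in>R. f (h(t := (a, r))) * pmf (p t a) r)"
      using assms(5)[OF that] assms(4) by (intro nn_integral_measure_pmf_support) auto
    finally show ?thesis .
  qed
  have "(\<integral>\<^sup>+y. f y \<partial>interaction_step K A p t h) =
    (\<integral>\<^sup>+a. \<integral>\<^sup>+y. f y \<partial>(borel_law (p t a) \<bind> (\<lambda>x. return ?H (h(t := (a, x))))) \<partial>A t h)"
    unfolding interaction_step_def
    by (intro nn_integral_bind[OF assms(2)]) (rule inner')
  also have "\<dots> = (\<Sum>a<K. (\<integral>\<^sup>+y. f y \<partial>(borel_law (p t a) \<bind> (\<lambda>x. return ?H (h(t := (a, x)))))) *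
      emeasure (A t h) {a})"
    by (rule nn_integral_finite_space[OF sets_Ah]) simp
  also have "\<dots> = (\<Sum>a<K. (\<Sum>r\<in>R. f (h(t := (a, r))) * pmf (p t a) r) * measure (A t h) {a})"
    by (intro sum.cong refl) (simp add: reward Ah.emeasure_eq_measure)
  finally show ?thesis
    by (simp add: sum_distrib_right sum_distrib_left ennreal_mult' mult_ac)
qed

text \<open>Induction on \<open>t\<close> with \<open>f\<close> arbitrary: integrating out the last
  round turns \<open>f\<close> into a function of the shorter history, to which the induction
  hypothesis applies. The common finite set \<open>R\<close> makes the range of the reward sums
  independent of the arms pulled.\<close>

lemma nn_integral_interaction:
  assumes "t \<le> T" "f \<in> borel_measurable (history_space K t)"
    and "finite R" "\<And>s a. s < T \<Longrightarrow> a < K \<Longrightarrow> set_pmf (p s a) \<subseteq> R"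
  shows "(\<integral>\<^sup>+h. f h \<partial>interaction K A (\<lambda>s a. borel_law (p s a)) t) =
    (\<Sum>w\<in>PiE {..<t} (\<lambda>_. {..<K}). \<Sum>\<sigma>\<in>PiE {..<t} (\<lambda>_. R).
       ennreal (path_weight A p w \<sigma> t) * f (transcript w \<sigma> t))"
  using assms(1,2)
proof (induction t arbitrary: f)
  case 0
  have "(\<lambda>_. undefined) \<in> space (history_space K 0)"
    by (simp add: space_history_space)
  then show ?case
    using 0 by (simp add: nn_integral_return path_weight_def likelihood_def transcript_def restrict_def)
next
  case (Suc t)
  let ?I = "interaction K A (\<lambda>s a. borel_law (p s a)) t"
  let ?W = "\<lambda>w \<sigma>. ennreal (path_weight A p w \<sigma> t)"
  have t: "t < T" using Suc by simp
  have sets_I: "sets ?I = sets (history_space K t)"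
    using interaction_in_prob_algebra[of t p] t by (simp add: space_prob_algebra)
  have step: "interaction_step K A p t \<in> history_space K t \<rightarrow>\<^sub>M subprob_algebra (history_space K (Suc t))"
    by (rule measurable_prob_algebraD[OF measurable_interaction_step[OF t]])
  have F: "(\<lambda>h. \<integral>\<^sup>+y. f y \<partial>interaction_step K A p t h) \<in> borel_measurable (history_space K t)"
    by (rule measurable_compose[OF step nn_integral_measurable_subprob_algebra[OF Suc.prems(2)]])
  have "(\<integral>\<^sup>+h. f h \<partial>interaction K A (\<lambda>s a. borel_law (p s a)) (Suc t)) =
      (\<integral>\<^sup>+h. f h \<partial>(?I \<bind> interaction_step K A p t))"
    by (simp add: interaction_step_def[abs_def])
  also have "\<dots> = (\<integral>\<^sup>+h. \<integral>\<^sup>+y. f y \<partial>interaction_step K A p t h \<partial>?I)"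
    using step sets_I by (intro nn_integral_bind[OF Suc.prems(2)]) (simp cong: measurable_cong_sets)
  also have "\<dots> = (\<Sum>w\<in>PiE {..<t} (\<lambda>_. {..<K}). \<Sum>\<sigma>\<in>PiE {..<t} (\<lambda>_. R).
      ?W w \<sigma> * (\<integral>\<^sup>+y. f y \<partial>interaction_step K A p t (transcript w \<sigma> t)))"
    using t by (intro Suc.IH F) auto
  also have "\<dots> = (\<Sum>w\<in>PiE {..<t} (\<lambda>_. {..<K}). \<Sum>\<sigma>\<in>PiE {..<t} (\<lambda>_. R). \<Sum>a<K. \<Sum>r\<in>R.
      ennreal (path_weight A p (w(t := a)) (\<sigma>(t := r)) (Suc t)) *
        f (transcript (w(t := a)) (\<sigma>(t := r)) (Suc t)))"
  proof (intro sum.cong refl)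
    fix w \<sigma> assume w: "w \<in> PiE {..<t} (\<lambda>_. {..<K})"
    show "?W w \<sigma> * (\<integral>\<^sup>+y. f y \<partial>interaction_step K A p t (transcript w \<sigma> t)) =
      (\<Sum>a<K. \<Sum>r\<in>R. ennreal (path_weight A p (w(t := a)) (\<sigma>(t := r)) (Suc t)) *
        f (transcript (w(t := a)) (\<sigma>(t := r)) (Suc t)))"
      using t Suc.prems(2) transcript_in_space[OF w] assms(3,4)
      by (subst nn_integral_interaction_step[where R = R])
         (simp_all del: fun_upd_apply add: sum_distrib_left transcript_Suc path_weight_Suc ennreal_mult'
          path_weight_nonneg mult_ac)
  qed
  also have "\<dots> = (\<Sum>w\<in>PiE {..<t} (\<lambda>_. {..<K}). \<Sum>a<K. \<Sum>\<sigma>\<in>PiE {..<t} (\<lambda>_. R). \<Sum>r\<in>R.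
      ennreal (path_weight A p (w(t := a)) (\<sigma>(t := r)) (Suc t)) *
        f (transcript (w(t := a)) (\<sigma>(t := r)) (Suc t)))"
    by (intro sum.cong refl sum.swap)
  finally show ?case
    by (simp only: sum_PiE_lessThan_Suc)
qed

context
  fixes p :: "nat \<Rightarrow> nat \<Rightarrow> real pmf" and R :: "real set"
  assumes finite_R: "finite R"
    and support: "\<And>s a. s < T \<Longrightarrow> a < K \<Longrightarrow> set_pmf (p s a) \<subseteq> R"
begin

text \<open>Rewards may be negative, so nonnegative integrals do not suffice for the regret.
  Evaluating them on indicators identifies the law itself as the image of a finite point measure,
  and this gives real integrals as well.\<close>

lemma interaction_eq_distr:
  assumes "t \<le> T"
  shows "interaction K A (\<lambda>s a. borel_law (p s a)) t =
    distr (point_measure (PiE {..<t} (\<lambda>_. {..<K}) \<times> PiE {..<t} (\<lambda>_. R))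
        (\<lambda>(w, \<sigma>). ennreal (path_weight A p w \<sigma> t)))
      (history_space K t) (\<lambda>(w, \<sigma>). transcript w \<sigma> t)"
    (is "?I = distr (point_measure ?\<Omega> ?W) ?H ?h")
proof (rule measure_eqI)
  have sets_I: "sets ?I = sets ?H"
    using interaction_in_prob_algebra[OF assms, of p] by (simp add: space_prob_algebra)
  then show "sets ?I = sets (distr (point_measure ?\<Omega> ?W) ?H ?h)" by simp
  have fin: "finite ?\<Omega>" using finite_R by (intro finite_cartesian_product finite_PiE) auto
  have h: "?h \<in> point_measure ?\<Omega> ?W \<rightarrow>\<^sub>M ?H"
    unfolding measurable_point_measure_eq1
  proof (rule Pi_I)
    fix z assume "z \<in> ?\<Omega>"
    then have "fst z \<in> PiE {..<t} (\<lambda>_. {..<K})" by (rule mem_Times_iff[THEN iffD1, THEN conjunct1])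
    then show "?h z \<in> space ?H"
      unfolding split_beta by (rule transcript_in_space)
  qed
  fix B assume "B \<in> sets ?I"
  then have B: "B \<in> sets ?H" using sets_I by simp
  have "emeasure ?I B = (\<integral>\<^sup>+h. indicator B h \<partial>?I)"
    using B sets_I by simp
  also have "\<dots> = (\<Sum>(w, \<sigma>)\<in>?\<Omega>. ennreal (path_weight A p w \<sigma> t) * indicator B (transcript w \<sigma> t))"
    using B support
    by (subst nn_integral_interaction[OF assms _ finite_R]) (auto simp: sum.cartesian_product)
  also have "\<dots> = (\<integral>\<^sup>+z. indicator B (?h z) \<partial>point_measure ?\<Omega> ?W)"
    by (simp add: nn_integral_point_measure_finite[OF fin] case_prod_unfold)
  also have "\<dots> = (\<integral>\<^sup>+y. indicator B y \<partial>distr (point_measure ?\<Omega> ?W) ?H ?h)"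
    using B by (subst nn_integral_distr[OF h]) auto
  also have "\<dots> = emeasure (distr (point_measure ?\<Omega> ?W) ?H ?h) B"
    using B by simp
  finally show "emeasure ?I B = emeasure (distr (point_measure ?\<Omega> ?W) ?H ?h) B" .
qed

lemma integral_interaction:
  fixes f :: "history \<Rightarrow> real"
  assumes "t \<le> T" "f \<in> borel_measurable (history_space K t)"
  shows "(\<integral>h. f h \<partial>interaction K A (\<lambda>s a. borel_law (p s a)) t) =
    (\<Sum>w\<in>PiE {..<t} (\<lambda>_. {..<K}). \<Sum>\<sigma>\<in>PiE {..<t} (\<lambda>_. R).
       path_weight A p w \<sigma> t * f (transcript w \<sigma> t))"
proof -
  have fin: "finite (PiE {..<t} (\<lambda>_. {..<K}) \<times> PiE {..<t} (\<lambda>_. R))"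
    using finite_R by (intro finite_cartesian_product finite_PiE) auto
  have "(\<lambda>(w, \<sigma>). ennreal (path_weight A p w \<sigma> t)) =
      (\<lambda>x. ennreal ((\<lambda>(w, \<sigma>). path_weight A p w \<sigma> t) x))"
    by (simp add: case_prod_unfold)
  then show ?thesis
    unfolding interaction_eq_distr[OF assms(1)] using assms(2) transcript_in_space
    by (subst integral_distr)
       (auto simp: lebesgue_integral_point_measure_finite[OF fin] path_weight_nonneg
          case_prod_unfold sum.cartesian_product)
qed

lemma sum_path_weight:
  assumes "t \<le> T"
  shows "(\<Sum>w\<in>PiE {..<t} (\<lambda>_. {..<K}). \<Sum>\<sigma>\<in>PiE {..<t} (\<lambda>_. R). path_weight A p w \<sigma> t) = 1"
proof -
  interpret I: prob_space "interaction K A (\<lambda>s a. borel_law (p s a)) t"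
    using interaction_in_prob_algebra[OF assms] by (simp add: space_prob_algebra)
  show ?thesis
    using integral_interaction[OF assms, of "\<lambda>_. 1"] I.prob_space by simp
qed

lemma sum_algorithm_eq_1:
  assumes "t < T" "h \<in> space (history_space K t)"
  shows "(\<Sum>a<K. measure (A t h) {a}) = 1"
proof -
  have Ah: "A t h \<in> space (prob_algebra (count_space {..<K}))"
    using measurable_space[OF measurable_algorithm[OF assms(1)] assms(2)] .
  then interpret Ah: prob_space "A t h" by (simp add: space_prob_algebra)
  have sets_Ah: "sets (A t h) = sets (count_space {..<K})"
    using Ah by (simp add: space_prob_algebra)
  have "measure (A t h) {..<K} = (\<Sum>a<K. measure (A t h) {a})"
    by (rule Ah.finite_measure_eq_sum_singleton) (simp_all add: sets_Ah)
  then show ?thesis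
    using Ah.prob_space sets_eq_imp_space_eq[OF sets_Ah] by simp
qed

text \<open>Given the past and the arm pulled, the new reward minus the mean of that arm averages to
  zero. Summing out the last reward and arm therefore leaves the centred sum of the earlier
  rounds.\<close>

lemma sum_path_weight_martingale:
  assumes "t \<le> T"
  shows "(\<Sum>w\<in>PiE {..<t} (\<lambda>_. {..<K}). \<Sum>\<sigma>\<in>PiE {..<t} (\<lambda>_. R).
    path_weight A p w \<sigma> t * (\<Sum>s<t. \<sigma> s - measure_pmf.expectation (p s (w s)) (\<lambda>x. x))) = 0"
  using assms
proof (induction t)
  case (Suc t)
  let ?m = "\<lambda>s a. measure_pmf.expectation (p s a) (\<lambda>x. x)"
  have t: "t < T" using Suc by simp
  have pmf_sum: "(\<Sum>r\<in>R. pmf (p t a) r) = 1" if "a < K" for a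
    using finite_R support[OF t that] by (intro sum_pmf_eq_1)
  have pmf_mean: "(\<Sum>r\<in>R. pmf (p t a) r * r) = ?m t a" if "a < K" for a
    using support[OF t that] by (subst integral_measure_pmf[OF finite_R]) auto
  have step: "(\<Sum>a<K. \<Sum>r\<in>R. path_weight A p (w(t := a)) (\<sigma>(t := r)) (Suc t) *
        (\<Sum>s<Suc t. (\<sigma>(t := r)) s - ?m s ((w(t := a)) s))) =
      path_weight A p w \<sigma> t * (\<Sum>s<t. \<sigma> s - ?m s (w s))"
    if w: "w \<in> PiE {..<t} (\<lambda>_. {..<K})" for w \<sigma>
  proof -
    let ?c = "path_weight A p w \<sigma> t" and ?S = "\<Sum>s<t. \<sigma> s - ?m s (w s)"
    let ?q = "\<lambda>a. measure (A t (transcript w \<sigma> t)) {a}"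
    have "(\<Sum>r\<in>R. path_weight A p (w(t := a)) (\<sigma>(t := r)) (Suc t) *
        (\<Sum>s<Suc t. (\<sigma>(t := r)) s - ?m s ((w(t := a)) s))) = ?c * ?S * ?q a" if "a < K" for a
    proof -
      have "(\<Sum>r\<in>R. path_weight A p (w(t := a)) (\<sigma>(t := r)) (Suc t) *
        (\<Sum>s<Suc t. (\<sigma>(t := r)) s - ?m s ((w(t := a)) s))) =
        (\<Sum>r\<in>R. ?c * ?q a * ((?S - ?m t a) * pmf (p t a) r + pmf (p t a) r * r))"
        unfolding path_weight_Suc by (intro sum.cong refl) (simp add: algebra_simps)
      \<comment> \<open>The first reward sum is the total mass 1 and the second is the mean, so the
        two occurrences of \<open>?m t a\<close> cancel.\<close>
      also have "\<dots> = ?c * ?q a * ((?S - ?m t a) * (\<Sum>r\<in>R. pmf (p t a) r)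
          + (\<Sum>r\<in>R. pmf (p t a) r * r))"
        by (simp only: sum_distrib_left[symmetric] sum.distrib)
      finally show ?thesis
        by (simp add: pmf_sum pmf_mean that)
    qed
    then show ?thesis
      using sum_algorithm_eq_1[OF t transcript_in_space[OF w]]
      by (simp flip: sum_distrib_left)
  qed
  have "(\<Sum>w\<in>PiE {..<Suc t} (\<lambda>_. {..<K}). \<Sum>\<sigma>\<in>PiE {..<Suc t} (\<lambda>_. R).
      path_weight A p w \<sigma> (Suc t) * (\<Sum>s<Suc t. \<sigma> s - ?m s (w s))) =
    (\<Sum>w\<in>PiE {..<t} (\<lambda>_. {..<K}). \<Sum>\<sigma>\<in>PiE {..<t} (\<lambda>_. R). \<Sum>a<K. \<Sum>r\<in>R.
      path_weight A p (w(t := a)) (\<sigma>(t := r)) (Suc t) *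
        (\<Sum>s<Suc t. (\<sigma>(t := r)) s - ?m s ((w(t := a)) s)))"
    unfolding sum_PiE_lessThan_Suc by (intro sum.cong refl sum.swap)
  also have "\<dots> = (\<Sum>w\<in>PiE {..<t} (\<lambda>_. {..<K}). \<Sum>\<sigma>\<in>PiE {..<t} (\<lambda>_. R).
      path_weight A p w \<sigma> t * (\<Sum>s<t. \<sigma> s - ?m s (w s)))"
    by (intro sum.cong refl step)
  finally show ?case
    using Suc by simp
qed simp

end

section \<open>Action sequences and the regret decomposition\<close>

definition action_weight :: "real set \<Rightarrow> (nat \<Rightarrow> real pmf) \<Rightarrow> (nat \<Rightarrow> nat) \<Rightarrow> real" where
  "action_weight R p w = (\<Sum>\<sigma>\<in>PiE {..<T} (\<lambda>_. R). path_weight A (\<lambda>_. p) w \<sigma> T)"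

lemma action_weight_nonneg: "0 \<le> action_weight R p w"
  by (simp add: action_weight_def sum_nonneg path_weight_nonneg)

lemma sum_action_weight:
  assumes "finite R" "\<And>a. a < K \<Longrightarrow> set_pmf (p a) \<subseteq> R"
  shows "(\<Sum>w\<in>PiE {..<T} (\<lambda>_. {..<K}). action_weight R p w) = 1"
  unfolding action_weight_def using sum_path_weight[of R "\<lambda>_. p" T] assms by simp

text \<open>By the martingale identity the rewards can be replaced in expectation by the means of
  the pulled arms. Since the path weights sum to 1, the term \<open>T * best_mean\<close> moves
  under the same sum, where it combines with the means into gaps.\<close>

lemma regret_eq_sum_gaps:
  assumes "finite R" "\<And>a. a < K \<Longrightarrow> set_pmf (p a) \<subseteq> R"
  defines "X \<equiv> \<lambda>a. borel_law (p a)"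
  shows "regret K T A X =
    (\<Sum>w\<in>PiE {..<T} (\<lambda>_. {..<K}). action_weight R p w * (\<Sum>t<T. gap K X (w t)))"
proof -
  let ?W = "\<lambda>w \<sigma>. path_weight A (\<lambda>_. p) w \<sigma> T"
  let ?m = "arm_mean X"
  let ?sum = "\<lambda>F. \<Sum>w\<in>PiE {..<T} (\<lambda>_. {..<K}). \<Sum>\<sigma>\<in>PiE {..<T} (\<lambda>_. R). ?W w \<sigma> * F w \<sigma>"
  have meas: "(\<lambda>h. \<Sum>t<T. snd (h t)) \<in> borel_measurable (history_space K T)"
    unfolding history_space_def by measurable
  have "(\<integral>h. (\<Sum>t<T. snd (h t)) \<partial>interaction K A (\<lambda>_. X) T) = ?sum (\<lambda>w \<sigma>. \<Sum>t<T. snd (transcript w \<sigma> T t))"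
    unfolding X_def using integral_interaction[of R "\<lambda>_. p" T, OF assms(1,2) _ meas] by simp
  also have "\<dots> = ?sum (\<lambda>w \<sigma>. \<Sum>t<T. \<sigma> t)"
    by (intro sum.cong refl arg_cong2[where f = "(*)"]) (simp add: transcript_def)
  finally have rewards: "(\<integral>h. (\<Sum>t<T. snd (h t)) \<partial>interaction K A (\<lambda>_. X) T) =
    ?sum (\<lambda>w \<sigma>. \<Sum>t<T. \<sigma> t)" .
  have "?sum (\<lambda>w \<sigma>. \<Sum>t<T. \<sigma> t - ?m (w t)) = 0"
    using sum_path_weight_martingale[of R "\<lambda>_. p" T] assms(1,2)
    by (simp add: X_def arm_mean_borel_law)
  then have "?sum (\<lambda>w \<sigma>. \<Sum>t<T. \<sigma> t) = ?sum (\<lambda>w \<sigma>. \<Sum>t<T. ?m (w t))"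
    by (simp add: sum_subtractf right_diff_distrib)
  moreover have "real T * best_mean K X = ?sum (\<lambda>w \<sigma>. \<Sum>t<T. best_mean K X)"
    using sum_path_weight[of R "\<lambda>_. p" T] assms(1,2) by (simp flip: sum_distrib_right)
  ultimately have "regret K T A X = ?sum (\<lambda>w \<sigma>. \<Sum>t<T. gap K X (w t))"
    unfolding regret_def rewards
    by (simp add: gap_def sum_subtractf right_diff_distrib)
  then show ?thesis
    by (simp add: action_weight_def sum_distrib_right)
qed

section \<open>Deterministic rewards and group privacy\<close>

lemma sum_path_weight_return_pmf:
  assumes "finite R" "\<And>s. s < T \<Longrightarrow> x s \<in> R" "\<And>s. s < T \<Longrightarrow> p s (w s) = return_pmf (x s)"
  shows "(\<Sum>\<sigma>\<in>PiE {..<T} (\<lambda>_. R). path_weight A p w \<sigma> T * c) = likelihood A w x T * c"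
proof -
  \<comment> \<open>The reward sequences summed over are undefined from \<open>T\<close> on, so the
    only one compatible with the point masses along \<open>w\<close> is the restriction of
    \<open>x\<close>.\<close>
  let ?x = "restrict x {..<T}"
  have "path_weight A p w \<sigma> T = (if \<sigma> = ?x then likelihood A w x T else 0)"
    if \<sigma>: "\<sigma> \<in> PiE {..<T} (\<lambda>_. R)" for \<sigma>
  proof (cases "\<sigma> = ?x")
    case True
    have "likelihood A w ?x T = likelihood A w x T"
      by (intro likelihood_cong) auto
    then show ?thesis
      using True assms by (simp add: path_weight_def)
  next
    case False
    then obtain s where s: "s < T" "\<sigma> s \<noteq> x s"
      using \<sigma> by (auto simp: fun_eq_iff PiE_def extensional_def restrict_def split: if_splits)
    then have "(\<Prod>s<T. pmf (p s (w s)) (\<sigma> s)) = 0"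
      using assms by (intro prod_zero bexI[of _ s]) (auto simp: indicator_def)
    then show ?thesis
      using False by (simp add: path_weight_def)
  qed
  moreover have "?x \<in> PiE {..<T} (\<lambda>_. R)" using assms by auto
  ultimately show ?thesis
    using assms(1)
    by (simp add: finite_PiE flip: sum_distrib_right)
qed

text \<open>With deterministic arms, a fixed \<open>w\<close> determines the whole reward stream.
  The probability of \<open>w\<close> under the bandit is therefore its probability on one fixed
  stream, which is the bridge to privacy. The value does not depend on \<open>R\<close>.\<close>

lemma action_weight_return_pmf:
  assumes "finite R" "\<And>a. a < K \<Longrightarrow> x a \<in> R" "w \<in> PiE {..<T} (\<lambda>_. {..<K})"
  shows "action_weight R (\<lambda>a. return_pmf (x a)) w = likelihood A w (\<lambda>s. x (w s)) T"
  unfolding action_weight_def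
  using sum_path_weight_return_pmf[where c = 1 and x = "\<lambda>s. x (w s)" and R = R and w = w
      and p = "\<lambda>_ a. return_pmf (x a)"] assms
  by (auto simp: PiE_iff)

text \<open>Privacy will be applied to the event that exactly \<open>w\<close> is played. The stream
  is treated as a family of point masses that vary with the round, so the sum over paths collapses
  to a likelihood.\<close>

lemma measure_algorithm_output_singleton:
  assumes "w \<in> PiE {..<T} (\<lambda>_. {..<K})"
  shows "{w} \<in> sets (action_space K T)"
    and "measure (algorithm_output K T A x) {w} = likelihood A w x T"
proof -
  have "{w} = PiE {..<T} (\<lambda>t. {w t})"
    using assms by (subst PiE_singleton) (auto simp: PiE_def)
  also have "\<dots> \<in> sets (action_space K T)"
    unfolding action_space_def using assms by (intro sets_PiM_I_finite) auto
  finally show w: "{w} \<in> sets (action_space K T)" .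
  let ?I = "interaction K A (\<lambda>t a. borel_law (return_pmf (x t))) T"
  have sets_I: "sets ?I = sets (history_space K T)"
    using interaction_in_prob_algebra[of T] by (simp add: space_prob_algebra)
  have acts: "(\<lambda>h. \<lambda>t\<in>{..<T}. fst (h t)) \<in> history_space K T \<rightarrow>\<^sub>M action_space K T"
    unfolding history_space_def action_space_def by measurable
  have "measure (algorithm_output K T A x) {w} =
      measure ?I ((\<lambda>h. \<lambda>t\<in>{..<T}. fst (h t)) -` {w} \<inter> space ?I)"
    unfolding algorithm_output_def borel_law_return_pmf[symmetric]
    using acts w sets_I by (intro measure_distr) (simp_all cong: measurable_cong_sets)
  also have "\<dots> = (\<integral>h. indicator ((\<lambda>h. \<lambda>t\<in>{..<T}. fst (h t)) -` {w}) h \<partial>?I)"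
    by simp
  also have "\<dots> = (\<integral>h. indicator {w} (\<lambda>t\<in>{..<T}. fst (h t)) \<partial>?I)"
    by (simp only: indicator_vimage)
  also have "\<dots> = (\<Sum>w'\<in>PiE {..<T} (\<lambda>_. {..<K}). \<Sum>\<sigma>\<in>PiE {..<T} (\<lambda>_. x ` {..<T}).
      path_weight A (\<lambda>t a. return_pmf (x t)) w' \<sigma> T *
        indicator {w} (\<lambda>t\<in>{..<T}. fst (transcript w' \<sigma> T t)))"
    using measurable_compose[OF acts borel_measurable_indicator[OF w]]
    by (intro integral_interaction) auto
  also have "\<dots> = (\<Sum>w'\<in>PiE {..<T} (\<lambda>_. {..<K}). \<Sum>\<sigma>\<in>PiE {..<T} (\<lambda>_. x ` {..<T}).
      path_weight A (\<lambda>t a. return_pmf (x t)) w' \<sigma> T * indicator {w} w')"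
  proof (intro sum.cong refl arg_cong2[where f = "(*)"] arg_cong[where f = "indicator {w}"])
    fix w' \<sigma> assume "w' \<in> PiE {..<T} (\<lambda>_. {..<K})"
    then show "(\<lambda>t\<in>{..<T}. fst (transcript w' \<sigma> T t)) = w'"
      by (auto simp: transcript_def restrict_def PiE_def extensional_def fun_eq_iff)
  qed
  also have "\<dots> = (\<Sum>w'\<in>PiE {..<T} (\<lambda>_. {..<K}). likelihood A w' x T * indicator {w} w')"
    by (intro sum.cong refl sum_path_weight_return_pmf) auto
  also have "\<dots> = likelihood A w x T"
    using assms by (simp add: indicator_def of_bool_def if_distrib[of "(*) _"] finite_PiE cong: if_cong)
  finally show "measure (algorithm_output K T A x) {w} = likelihood A w x T" .
qed

text \<open>A hybrid argument: \<open>z j\<close> has the rewards of \<open>x\<close> before round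
  \<open>j\<close> and those of \<open>y\<close> from then on. Passing to \<open>z (Suc j)\<close>
  is free if the streams agree in round \<open>j\<close>; otherwise the two hybrids are adjacent and
  privacy costs the factor \<open>exp (- \<epsilon>)\<close>.\<close>

lemma likelihood_group_privacy:
  assumes "differentially_private K T \<epsilon> A" "0 \<le> \<epsilon>" "w \<in> PiE {..<T} (\<lambda>_. {..<K})"
  shows "likelihood A w y T * (\<Prod>s<T. if x s = y s then 1 else exp (- \<epsilon>)) \<le> likelihood A w x T"
proof -
  define z where "z j = (\<lambda>s. if s < j then x s else y s)" for j
  have "likelihood A w y T * (\<Prod>s<j. if x s = y s then 1 else exp (- \<epsilon>)) \<le> likelihood A w (z j) T"
    if "j \<le> T" for j
    using that
  proof (induction j)
    case 0
    then show ?case by (simp add: z_def)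
  next
    case (Suc j)
    have "likelihood A w (z j) T * (if x j = y j then 1 else exp (- \<epsilon>)) \<le> likelihood A w (z (Suc j)) T"
    proof (cases "x j = y j")
      case True
      then have "z (Suc j) = z j" by (auto simp: z_def less_Suc_eq split: if_splits)
      then show ?thesis using True by simp
    next
      case False
      have "adjacent T (z j) (z (Suc j))"
        unfolding adjacent_def
        using False Suc.prems by (intro ex1I[of _ j]) (auto simp: z_def less_Suc_eq split: if_splits)
      then have "likelihood A w (z j) T \<le> exp \<epsilon> * likelihood A w (z (Suc j)) T"
        using assms(1) measure_algorithm_output_singleton[OF assms(3)]
        unfolding differentially_private_def by fastforce
      then show ?thesis
        using False by (simp add: exp_minus field_simps)
    qed
    moreover have "likelihood A w y T * (\<Prod>s<Suc j. if x s = y s then 1 else exp (- \<epsilon>)) \<le>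
        likelihood A w (z j) T * (if x j = y j then 1 else exp (- \<epsilon>))"
      using Suc by (auto simp: mult.assoc[symmetric] intro: mult_right_mono)
    ultimately show ?case by linarith
  qed
  \<comment> \<open>\<open>z T\<close> and \<open>x\<close> may differ from round \<open>T\<close>
    on, which the likelihood does not see.\<close>
  moreover have "likelihood A w (z T) T = likelihood A w x T"
    by (intro likelihood_cong) (auto simp: z_def)
  ultimately show ?thesis by (metis order_refl)
qed

text \<open>Group privacy compares each reward sequence \<sigma> with the deterministic stream along
  \<open>w\<close>. Averaging over \<sigma> with \<open>w\<close> fixed, the rewards are
  independent, so the mean of the product of the privacy costs is the product of their one-round
  means.\<close>

lemma action_weight_privacy:
  assumes "differentially_private K T \<epsilon> A" "0 \<le> \<epsilon>" "w \<in> PiE {..<T} (\<lambda>_. {..<K})"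
    and "finite R" "\<And>a. a < K \<Longrightarrow> x a \<in> R"
  shows "action_weight R (\<lambda>a. return_pmf (x a)) w *
      (\<Prod>s<T. \<Sum>r\<in>R. pmf (p (w s)) r * (if r = x (w s) then 1 else exp (- \<epsilon>))) \<le> action_weight R p w"
proof -
  let ?L = "likelihood A w (\<lambda>s. x (w s)) T"
  let ?e = "\<lambda>s r. if r = x (w s) then 1 else exp (- \<epsilon>)"
  have "?L * (\<Prod>s<T. \<Sum>r\<in>R. pmf (p (w s)) r * ?e s r) =
    (\<Sum>\<sigma>\<in>PiE {..<T} (\<lambda>_. R). ?L * (\<Prod>s<T. pmf (p (w s)) (\<sigma> s) * ?e s (\<sigma> s)))"
    using assms(4) by (subst prod_sum_PiE) (simp_all add: sum_distrib_left)
  also have "\<dots> = (\<Sum>\<sigma>\<in>PiE {..<T} (\<lambda>_. R).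
      ?L * (\<Prod>s<T. ?e s (\<sigma> s)) * (\<Prod>s<T. pmf (p (w s)) (\<sigma> s)))"
    by (simp add: prod.distrib mult_ac)
  also have "\<dots> \<le> (\<Sum>\<sigma>\<in>PiE {..<T} (\<lambda>_. R).
      likelihood A w \<sigma> T * (\<Prod>s<T. pmf (p (w s)) (\<sigma> s)))"
    using likelihood_group_privacy[OF assms(1-3)]
    by (intro sum_mono mult_right_mono prod_nonneg) auto
  also have "\<dots> = action_weight R p w"
    by (simp add: action_weight_def path_weight_def)
  finally show ?thesis
    using assms by (simp add: action_weight_return_pmf)
qed

end

section \<open>Privacy against rare spikes\<close>

definition pulls :: "nat \<Rightarrow> nat \<Rightarrow> (nat \<Rightarrow> nat) \<Rightarrow> nat" where
  "pulls T a w = card {t. t < T \<and> w t = a}"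

definition spiked_pmf :: "real \<Rightarrow> real \<Rightarrow> real \<Rightarrow> real pmf" where
  "spiked_pmf \<beta> M y = map_pmf (\<lambda>b. if b then M else y) (bernoulli_pmf \<beta>)"

lemma set_spiked_pmf: "set_pmf (spiked_pmf \<beta> M y) \<subseteq> {M, y}"
  by (auto simp: spiked_pmf_def)

lemma expectation_spiked_pmf:
  fixes f :: "real \<Rightarrow> real"
  assumes "0 \<le> \<beta>" "\<beta> \<le> 1"
  shows "measure_pmf.expectation (spiked_pmf \<beta> M y) f = \<beta> * f M + (1 - \<beta>) * f y"
  using assms by (simp add: spiked_pmf_def)

text \<open>In the bound \<open>ln (1 - y) \<ge> - y - 2 * y^2\<close>, the assumption
  \<open>y \<le> 1/2\<close> absorbs the quadratic term into a second \<open>y\<close>.\<close>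

lemma exp_le_one_minus:
  fixes y :: real
  assumes "0 \<le> y" "y \<le> 1/2"
  shows "exp (- 2 * y) \<le> 1 - y"
proof -
  have "y * y \<le> y * (1/2)" using assms by (intro mult_left_mono)
  then have "- 2 * y \<le> - y - 2 * y\<^sup>2" by (simp add: power2_eq_square)
  also have "\<dots> \<le> ln (1 - y)" using assms by (intro ln_one_minus_pos_lower_bound)
  finally show ?thesis using assms by (simp add: ln_ge_iff)
qed

lemma sum_count_pulls:
  assumes "w \<in> PiE {..<T} (\<lambda>_. {..<K})"
  shows "(\<Sum>t<T. g (w t)) = (\<Sum>a<K. real (pulls T a w) * (g a :: real))"
proof -
  have "(\<Sum>t<T. g (w t)) = (\<Sum>a<K. \<Sum>t | t \<in> {..<T} \<and> w t = a. g (w t))"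
    using assms by (intro sum.group[symmetric]) auto
  also have "\<dots> = (\<Sum>a<K. real (pulls T a w) * g a)"
    by (intro sum.cong refl) (simp add: pulls_def)
  finally show ?thesis .
qed

text \<open>Turns the horizon condition \<open>(4 / d) ^ 8 < T\<close> into
  \<open>4 / d < T powr (1/8)\<close>, the form in which it beats the gap between the exponents 7/8
  and 3/4.\<close>

lemma less_powr_eighth:
  fixes y z :: real
  assumes "0 < y" "y ^ 8 < z"
  shows "y < z powr (1/8)"
proof -
  have "0 < z"
    using assms zero_less_power[OF assms(1)] less_trans by blast
  then have "(z powr (1/8)) ^ 8 = z"
    by (simp add: powr_power)
  then show ?thesis
    using assms by (intro power_less_imp_less_base[of y 8]) auto
qed

section \<open>Comparing the deterministic instance with a spiked one\<close>

context bandit_run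
begin

context
  fixes x :: "nat \<Rightarrow> real" and a :: nat and \<epsilon> \<beta> M :: real
  assumes dp: "differentially_private K T \<epsilon> A"
    and eps: "0 < \<epsilon>" "\<epsilon> \<le> 1"
    and beta: "0 \<le> \<beta>" "\<beta> \<le> 1/2"
    and a: "a < K"
    and x: "\<And>b. b < K \<Longrightarrow> x b \<noteq> M"
begin

private abbreviation "R \<equiv> insert M (x ` {..<K})"
private abbreviation "base \<equiv> \<lambda>b. return_pmf (x b)"
private abbreviation "spiked \<equiv> base(a := spiked_pmf \<beta> M (x a))"

lemma spiked_support: "b < K \<Longrightarrow> set_pmf (spiked b) \<subseteq> R"
  using set_spiked_pmf[of \<beta> M "x a"] a by auto

lemma action_weight_spiked_ge:
  assumes w: "w \<in> PiE {..<T} (\<lambda>_. {..<K})"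
  shows "action_weight R base w * exp (- 2 * (\<beta> * \<epsilon>) * pulls T a w) \<le> action_weight R spiked w"
proof -
  let ?c = "1 - \<beta> * (1 - exp (- \<epsilon>))"
  \<comment> \<open>Only a spike deviates from the deterministic reward. It has probability \<beta>
    and can occur on arm \<open>a\<close> alone, which gives
    \<open>(1 - \<beta>) + \<beta> * exp (- \<epsilon>)\<close> there and 1 on all other
    arms.\<close>
  have factor: "(\<Sum>r\<in>R. pmf (spiked b) r * (if r = x b then 1 else exp (- \<epsilon>))) =
      (if b = a then ?c else 1)" if b: "b < K" for b
  proof -
    have "(\<Sum>r\<in>R. pmf (spiked b) r * (if r = x b then 1 else exp (- \<epsilon>))) =
      measure_pmf.expectation (spiked b) (\<lambda>r. if r = x b then 1 else exp (- \<epsilon>))"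
      using spiked_support[OF b] by (subst integral_measure_pmf[of R]) auto
    then show ?thesis
      using beta x[OF a] by (auto simp: expectation_spiked_pmf algebra_simps)
  qed
  have be: "0 \<le> \<beta> * \<epsilon>" "\<beta> * \<epsilon> \<le> 1/2"
    using eps beta mult_mono[of \<beta> "1/2" \<epsilon> 1] by auto
  \<comment> \<open>The linear bound \<open>1 - exp (- \<epsilon>) \<le> \<epsilon>\<close> makes
    the loss rate proportional to \<epsilon>; this is the source of the factor
    \<open>1 / \<epsilon>\<close> in the final bound.\<close>
  have "\<beta> * (1 - exp (- \<epsilon>)) \<le> \<beta> * \<epsilon>"
    using exp_ge_add_one_self[of "- \<epsilon>"] beta by (intro mult_left_mono) auto
  then have c: "exp (- 2 * (\<beta> * \<epsilon>)) \<le> ?c"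
    using exp_le_one_minus[OF be] by linarith
  have "(\<Prod>s<T. \<Sum>r\<in>R. pmf (spiked (w s)) r * (if r = x (w s) then 1 else exp (- \<epsilon>))) =
    (\<Prod>s<T. if w s = a then ?c else 1)"
    using w by (intro prod.cong refl factor) auto
  also have "\<dots> = ?c ^ pulls T a w"
    by (simp add: prod.If_cases pulls_def Collect_conj_eq lessThan_def)
  finally have "action_weight R base w * ?c ^ pulls T a w \<le> action_weight R spiked w"
    using action_weight_privacy[OF dp _ w, of R x spiked] eps by simp
  moreover have "exp (- 2 * (\<beta> * \<epsilon>)) ^ pulls T a w \<le> ?c ^ pulls T a w"
    using c by (intro power_mono) auto
  then have "exp (- 2 * (\<beta> * \<epsilon>) * pulls T a w) \<le> ?c ^ pulls T a w"
    by (simp add: exp_of_nat_mult[symmetric] mult_ac)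
  then have "action_weight R base w * exp (- 2 * (\<beta> * \<epsilon>) * pulls T a w) \<le>
      action_weight R base w * ?c ^ pulls T a w"
    by (intro mult_left_mono action_weight_nonneg)
  ultimately show ?thesis by linarith
qed

text \<open>A sequence in \<open>S\<close> plays other arms in at least \<open>T - m\<close> rounds,
  each at a cost of at least \<open>d\<close> once \<open>a\<close> carries the spike. Its
  probability shrinks by at most the exponential factor on passing to the spiked instance, because
  it pulls \<open>a\<close> at most \<open>m\<close> times.\<close>

lemma regret_spiked_ge:
  fixes m :: real
  assumes "0 < d" "x a = - d" "\<beta> * M = 2 * d" "\<And>b. b < K \<Longrightarrow> x b \<le> 0"
    and S: "S \<subseteq> PiE {..<T} (\<lambda>_. {..<K})" "\<And>w. w \<in> S \<Longrightarrow> pulls T a w \<le> m" and "m \<le> T"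
  shows "exp (- 2 * (\<beta> * \<epsilon>) * m) * (d * (T - m)) * (\<Sum>w\<in>S. action_weight R base w)
    \<le> regret K T A (\<lambda>b. borel_law (spiked b))"
proof -
  let ?Y = "\<lambda>b. borel_law (spiked b)"
  have fin: "finite (PiE {..<T} (\<lambda>_. {..<K}))" by (intro finite_PiE) auto
  \<comment> \<open>The mean is \<open>\<beta> * M - (1 - \<beta>) * d = d + \<beta> * d\<close>,
    while every other arm keeps a mean of at most 0.\<close>
  have mean_a: "d \<le> arm_mean ?Y a"
    using assms beta mult_nonneg_nonneg[of \<beta> d]
    by (simp add: arm_mean_borel_law expectation_spiked_pmf algebra_simps)
  have best: "arm_mean ?Y b \<le> best_mean K ?Y" if "b < K" for b
    unfolding best_mean_def using that by (intro Max_ge) auto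
  have "arm_mean ?Y b \<le> 0" if "b < K" "b \<noteq> a" for b
    using assms(4)[OF that(1)] that(2) by (simp add: arm_mean_borel_law)
  then have gap_other: "d \<le> gap K ?Y b" if "b < K" "b \<noteq> a" for b
    using mean_a best[OF a] that unfolding gap_def by force
  have gap_nonneg: "0 \<le> gap K ?Y b" if "b < K" for b
    using best[OF that] by (simp add: gap_def)
  have gaps_nonneg: "0 \<le> (\<Sum>t<T. gap K ?Y (w t))" if "w \<in> PiE {..<T} (\<lambda>_. {..<K})" for w
    using that by (intro sum_nonneg gap_nonneg) auto
  have summand: "exp (- 2 * (\<beta> * \<epsilon>) * m) * (d * (T - m)) * action_weight R base w \<le>
      action_weight R spiked w * (\<Sum>t<T. gap K ?Y (w t))" if w: "w \<in> S" for w
  proof -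
    have w': "w \<in> PiE {..<T} (\<lambda>_. {..<K})" using w S by auto
    have "d * (T - m) \<le> d * (real T - real (pulls T a w))"
      using assms(1) S(2)[OF w] by simp
    also have "\<dots> = (\<Sum>t<T. d - (if w t = a then d else 0))"
    proof -
      have "(\<Sum>t<T. if w t = a then d else 0) = d * pulls T a w"
        by (simp add: sum.If_cases pulls_def Collect_conj_eq lessThan_def)
      then show ?thesis by (simp add: sum_subtractf algebra_simps)
    qed
    also have "\<dots> \<le> (\<Sum>t<T. gap K ?Y (w t))"
      using w' gap_other gap_nonneg by (intro sum_mono) (auto simp: PiE_iff)
    finally have gaps: "d * (T - m) \<le> (\<Sum>t<T. gap K ?Y (w t))" .
    have "exp (- 2 * (\<beta> * \<epsilon>) * m) * action_weight R base w \<le>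
        exp (- 2 * (\<beta> * \<epsilon>) * pulls T a w) * action_weight R base w"
      using S(2)[OF w] eps beta
      by (intro mult_right_mono action_weight_nonneg) (simp add: mult_left_mono)
    also have "\<dots> \<le> action_weight R spiked w"
      using action_weight_spiked_ge[OF w'] by (simp add: mult_ac)
    finally have "(exp (- 2 * (\<beta> * \<epsilon>) * m) * action_weight R base w) * (d * (T - m)) \<le>
        action_weight R spiked w * (\<Sum>t<T. gap K ?Y (w t))"
      using gaps assms(1) \<open>m \<le> T\<close> by (intro mult_mono action_weight_nonneg) auto
    then show ?thesis by (simp add: mult_ac)
  qed
  have "exp (- 2 * (\<beta> * \<epsilon>) * m) * (d * (T - m)) * (\<Sum>w\<in>S. action_weight R base w) \<le>
      (\<Sum>w\<in>S. action_weight R spiked w * (\<Sum>t<T. gap K ?Y (w t)))"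
    by (subst sum_distrib_left) (intro sum_mono summand)
  also have "\<dots> \<le> (\<Sum>w\<in>PiE {..<T} (\<lambda>_. {..<K}). action_weight R spiked w * (\<Sum>t<T. gap K ?Y (w t)))"
    using S(1) fin by (intro sum_mono2 mult_nonneg_nonneg action_weight_nonneg gaps_nonneg) auto
  also have "\<dots> = regret K T A ?Y"
    using spiked_support by (intro regret_eq_sum_gaps[symmetric]) auto
  finally show ?thesis .
qed

text \<open>The first bound on \<open>m\<close> leaves at least \<open>T / 2\<close> rounds for bad
  arms, and the second limits the privacy loss to the factor \<open>T powr (-1/8)\<close>. Too few
  expected pulls would thus force a regret above \<open>T powr (7/8) * (d / 4)\<close>, which
  exceeds the guarantee as \<open>4 / d < T powr (1/8)\<close>.\<close>

lemma expected_pulls_ge: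
  assumes d: "0 < d" "x a = - d" "\<beta> * M = 2 * d" "\<And>b. b < K \<Longrightarrow> x b \<le> 0"
    and T: "(4 / d) ^ 8 < T"
    and regret: "regret K T A (\<lambda>b. borel_law (spiked b)) \<le> T powr (3/4)"
    and m: "m \<le> T / 2" "2 * (\<beta> * \<epsilon>) * m \<le> ln T / 8"
  shows "m / 2 \<le> (\<Sum>w\<in>PiE {..<T} (\<lambda>_. {..<K}). action_weight R base w * pulls T a w)"
proof (rule ccontr)
  let ?\<Omega> = "PiE {..<T} (\<lambda>_. {..<K})"
  assume "\<not> ?thesis"
  then have less: "(\<Sum>w\<in>?\<Omega>. action_weight R base w * pulls T a w) < m / 2" by simp
  have fin: "finite ?\<Omega>" by (intro finite_PiE) auto
  have "0 \<le> (\<Sum>w\<in>?\<Omega>. action_weight R base w * pulls T a w)"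
    by (intro sum_nonneg mult_nonneg_nonneg action_weight_nonneg) auto
  with less have m_pos: "0 < m" by linarith
  define S where "S = {w \<in> ?\<Omega>. pulls T a w \<le> m}"
  have not_S: "m \<le> pulls T a w" if "w \<in> ?\<Omega> - S" for w
    by (rule ccontr) (use that in \<open>simp add: S_def\<close>)
  \<comment> \<open>Markov's inequality for the number of pulls: sequences outside \<open>S\<close>
    have total weight below 1/2.\<close>
  have "m * (\<Sum>w\<in>?\<Omega> - S. action_weight R base w) = (\<Sum>w\<in>?\<Omega> - S. action_weight R base w * m)"
    by (subst sum_distrib_left) (simp only: mult.commute)
  also have "\<dots> \<le> (\<Sum>w\<in>?\<Omega> - S. action_weight R base w * pulls T a w)"
    using not_S by (intro sum_mono mult_left_mono action_weight_nonneg)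
  also have "\<dots> \<le> (\<Sum>w\<in>?\<Omega>. action_weight R base w * pulls T a w)"
    using fin by (intro sum_mono2 mult_nonneg_nonneg action_weight_nonneg) auto
  also note less
  finally have "(\<Sum>w\<in>?\<Omega> - S. action_weight R base w) < 1/2"
    using m_pos by simp
  moreover have "(\<Sum>w\<in>?\<Omega>. action_weight R base w) = 1"
    by (intro sum_action_weight) auto
  moreover have "S \<subseteq> ?\<Omega>" unfolding S_def by (rule Collect_subset)
  ultimately have half: "1/2 < (\<Sum>w\<in>S. action_weight R base w)"
    using sum.subset_diff[OF \<open>S \<subseteq> ?\<Omega>\<close> fin, of "action_weight R base"] by linarith
  have T_pos: "0 < real T"
    by (rule le_less_trans[OF zero_le_power T]) (use d(1) in simp)
  \<comment> \<open>The three factors on the right are the bounds for the privacy loss, for the cost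
    of the bad rounds and for the weight of \<open>S\<close>.\<close>
  have "T powr (7/8) * (d / 4) = exp (- (ln T / 8)) * (d * (T / 2)) * (1/2)"
  proof -
    have "T powr (7/8) = T powr (- 1/8 + 1)" by simp
    also have "\<dots> = T powr (-1/8) * T"
      using T_pos by (subst powr_add) simp
    finally show ?thesis
      using T_pos by (simp add: powr_def)
  qed
  also have "\<dots> \<le> exp (- 2 * (\<beta> * \<epsilon>) * m) * (d * (T - m)) * (1/2)"
    using m d(1) by (intro mult_right_mono mult_mono) auto
  also have "\<dots> < exp (- 2 * (\<beta> * \<epsilon>) * m) * (d * (T - m)) * (\<Sum>w\<in>S. action_weight R base w)"
    using half m T_pos d(1) by (intro mult_strict_left_mono) auto
  also have "\<dots> \<le> regret K T A (\<lambda>b. borel_law (spiked b))"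
    using m T_pos \<open>S \<subseteq> ?\<Omega>\<close> by (intro regret_spiked_ge[OF d]) (simp_all add: S_def)
  also note regret
  finally have "T powr (1/8) * T powr (3/4) * (d / 4) < T powr (3/4)"
    by (simp flip: powr_add)
  then have "T powr (1/8) * (d / 4) < 1"
    using T_pos by (simp add: mult_ac)
  then have "T powr (1/8) < 4 / d"
    using d(1) by (simp add: field_simps)
  moreover have "4 / d < T powr (1/8)"
    using d(1) T by (intro less_powr_eighth) auto
  ultimately show False by simp
qed

end

end

section \<open>The lower bound\<close>

text \<open>The spike contributes \<open>(\<beta> * M) * M powr v = 2 * d * 3 * u / (8 * d) = 3 * u
  / 4\<close>. The ordinary value contributes at most
  \<open>d powr (1 + v) \<le> d \<le> u / 4\<close>.\<close>

lemma moment_spiked_pmf: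
  assumes "0 < v" "0 < u" "u \<le> 1" "0 < d" "d \<le> 1" "d \<le> u / 4"
    and "0 < M" "M powr v = 3 * u / (8 * d)" "0 \<le> \<beta>" "\<beta> \<le> 1" "\<beta> * M = 2 * d"
  shows "measure_pmf.expectation (spiked_pmf \<beta> M (- d)) (\<lambda>x. \<bar>x\<bar> powr (1 + v)) \<le> u"
proof -
  have "\<beta> * M powr (1 + v) = \<beta> * M * M powr v"
    using assms(7) by (simp add: powr_add)
  also have "\<dots> = 3 * u / 4"
    using assms(4,8,11) by simp
  finally have "\<beta> * M powr (1 + v) = 3 * u / 4" .
  moreover have "d powr (1 + v) \<le> d powr 1"
    using assms by (intro powr_mono') auto
  then have "d powr (1 + v) \<le> u / 4" using assms(4,6) by simp
  moreover have "(1 - \<beta>) * d powr (1 + v) \<le> 1 * d powr (1 + v)"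
    using assms(9) by (intro mult_right_mono) auto
  ultimately have "\<beta> * M powr (1 + v) + (1 - \<beta>) * d powr (1 + v) \<le> u"
    by linarith
  then show ?thesis
    using assms(4,7,9,10) by (simp add: expectation_spiked_pmf)
qed

theorem theorem5:
  fixes v u :: real
  assumes "0 < v" and "v \<le> 1" and "0 < u" and "u \<le> 1"
  shows "\<exists>c>0. \<forall>(K::nat) (\<delta>::nat \<Rightarrow> real). gap_profile K u \<delta> \<longrightarrow>
    (\<exists>X. heavy_tailed_bandit K v u X \<and>
         (\<forall>a<K. arm_mean X a \<le> 1/6 \<and> gap K X a = \<delta> a) \<and>
         (\<forall>N. \<exists>T0. \<forall>T\<ge>T0. \<forall>\<epsilon> A.
            0 < \<epsilon> \<and> \<epsilon> \<le> 1 \<and> bandit_algorithm K T A \<and> differentially_private K T \<epsilon> A \<and>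
            regret_guarantee K v u N T A \<longrightarrow>
            regret K T A X \<ge>
              c * (ln (real T) / \<epsilon> * (\<Sum>a | a < K \<and> gap K X a > 0. (1 / gap K X a) powr (1 / v)))))"
proof -
  \<comment> \<open>Chosen so that the spike height \<open>M a\<close> equals
    \<open>64 * c * (1 / \<delta> a) powr (1 / v)\<close>. The number 64 is the 32 of the pull bound
    times the 2 in \<open>\<beta> a = 2 * \<delta> a / M a\<close>.\<close>
  define c where "c = (3 * u / 8) powr (1 / v) / 64"
  have "0 < c" using assms by (simp add: c_def)
  moreover have "\<exists>X. heavy_tailed_bandit K v u X \<and>
         (\<forall>a<K. arm_mean X a \<le> 1/6 \<and> gap K X a = \<delta> a) \<and>
         (\<forall>N. \<exists>T0. \<forall>T\<ge>T0. \<forall>\<epsilon> A.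
            0 < \<epsilon> \<and> \<epsilon> \<le> 1 \<and> bandit_algorithm K T A \<and> differentially_private K T \<epsilon> A \<and>
            regret_guarantee K v u N T A \<longrightarrow>
            regret K T A X \<ge>
              c * (ln (real T) / \<epsilon> * (\<Sum>a | a < K \<and> gap K X a > 0. (1 / gap K X a) powr (1 / v))))"
    if profile: "gap_profile K u \<delta>" for K \<delta>
  proof -
    define base where "base = (\<lambda>a. return_pmf (- \<delta> a))"
    define X where "X = (\<lambda>a. borel_law (base a))"
    \<comment> \<open>The height spends three quarters of the moment budget \<open>u\<close> on the
      spike, and \<beta> then lifts arm \<open>a\<close> above the optimal mean 0 by at least its
      former gap.\<close>
    define M where "M a = (3 * u / (8 * \<delta> a)) powr (1 / v)" for a
    define \<beta> where "\<beta> a = 2 * \<delta> a / M a" for a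
    define spiked where "spiked a = base(a := spiked_pmf (\<beta> a) (M a) (- \<delta> a))" for a
    define Y where "Y a = (\<lambda>b. borel_law (spiked a b))" for a
    have gaps: "\<delta> a = 0 \<or> 0 < \<delta> a \<and> \<delta> a < 1/12 \<and> \<delta> a \<le> u / 4" if "a < K" for a
      using profile that by (auto simp: gap_profile_def)
    then have gap_nonneg: "0 \<le> \<delta> a" if "a < K" for a using that by fastforce
    have mean_X: "arm_mean X a = - \<delta> a" for a
      by (simp add: X_def base_def arm_mean_borel_law)
    obtain a0 where a0: "a0 < K" "\<delta> a0 = 0"
      using profile by (auto simp: gap_profile_def)
    have "best_mean K X = 0"
      unfolding best_mean_def
      by (rule Max_eqI) (use gap_nonneg a0 mean_X in \<open>auto intro!: image_eqI[of _ _ a0]\<close>)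
    then have gap_X: "gap K X a = \<delta> a" for a
      by (simp add: gap_def mean_X)
    have base_moment: "measure_pmf.expectation (base a) (\<lambda>x. \<bar>x\<bar> powr (1 + v)) \<le> u" if "a < K" for a
    proof (cases "\<delta> a = 0")
      case False
      then have "0 < \<delta> a" "\<delta> a < 1/12" "\<delta> a \<le> u / 4" using gaps[OF that] by auto
      then have "\<delta> a powr (1 + v) \<le> \<delta> a powr 1"
        using assms by (intro powr_mono') auto
      then show ?thesis
        using \<open>0 < \<delta> a\<close> \<open>\<delta> a \<le> u / 4\<close> assms by (simp add: base_def)
    qed (use assms in \<open>simp add: base_def\<close>)
    have heavy: "heavy_tailed_bandit K v u (\<lambda>b. borel_law (p b))"
      if "\<And>b. b < K \<Longrightarrow> finite (set_pmf (p b))"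
        and "\<And>b. b < K \<Longrightarrow> measure_pmf.expectation (p b) (\<lambda>x. \<bar>x\<bar> powr (1 + v)) \<le> u" for p
      unfolding heavy_tailed_bandit_def using that
      by (auto intro!: prob_space_borel_law integrable_borel_law simp: integral_borel_law)
    have heavy_X: "heavy_tailed_bandit K v u X"
      unfolding X_def by (rule heavy) (auto simp: base_moment, simp add: base_def)
    have spike: "0 < M a" "M a powr v = 3 * u / (8 * \<delta> a)" "0 < \<beta> a" "\<beta> a \<le> 1/2"
      "\<beta> a * M a = 2 * \<delta> a" if "a < K" "0 < \<delta> a" for a
    proof -
      have \<delta>: "\<delta> a < 1/12" "\<delta> a \<le> u / 4" using gaps[OF that(1)] that(2) by auto
      \<comment> \<open>From \<open>\<delta> a \<le> u / 4\<close> one gets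
        \<open>8 * \<delta> a \<le> 2 * u\<close>. Hence the height is at least 1 and \<beta> is at
        most \<open>2 * \<delta> a\<close>, which is below 1/6.\<close>
      have ratio: "1 \<le> 3 * u / (8 * \<delta> a)" using \<delta> that(2) by (simp add: field_simps)
      then have M: "1 \<le> M a" unfolding M_def using assms by (intro ge_one_powr_ge_zero) auto
      then show "0 < M a" by simp
      then show "0 < \<beta> a" "\<beta> a * M a = 2 * \<delta> a" using that(2) by (simp_all add: \<beta>_def)
      show "M a powr v = 3 * u / (8 * \<delta> a)"
        using assms that(2) by (simp add: M_def powr_powr)
      show "\<beta> a \<le> 1/2" using M \<delta> that(2) by (simp add: \<beta>_def field_simps)
    qed
    have heavy_Y: "heavy_tailed_bandit K v u (Y a)" if "a < K" "0 < \<delta> a" for a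
      unfolding Y_def
    proof (rule heavy)
      fix b assume b: "b < K"
      have "finite (set_pmf (spiked_pmf (\<beta> a) (M a) (- \<delta> a)))"
        by (rule finite_subset[OF set_spiked_pmf]) simp
      then show "finite (set_pmf (spiked a b))"
        by (simp add: spiked_def base_def)
      have "measure_pmf.expectation (spiked_pmf (\<beta> a) (M a) (- \<delta> a)) (\<lambda>x. \<bar>x\<bar> powr (1 + v)) \<le> u"
        using spike[OF that] gaps[OF that(1)] that assms by (intro moment_spiked_pmf) auto
      then show "measure_pmf.expectation (spiked a b) (\<lambda>x. \<bar>x\<bar> powr (1 + v)) \<le> u"
        using base_moment[OF b] by (simp add: spiked_def)
    qed
    \<comment> \<open>The horizon threshold covers \<open>X\<close>, all competing instances and all
      gaps, and involves neither \<epsilon> nor the algorithm. For optimal arms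
      \<open>4 / 0 = 0\<close> makes the gap term vanish; the final 1 yields strict
      inequalities.\<close>
    have lower: "c * (ln (real T) / \<epsilon> * (\<Sum>a | a < K \<and> gap K X a > 0. (1 / gap K X a) powr (1 / v)))
        \<le> regret K T A X"
      if T: "N X + (\<Sum>a<K. N (Y a)) + (\<Sum>a<K. nat \<lceil>(4 / \<delta> a) ^ 8\<rceil>) + 1 \<le> T"
        and eps: "0 < \<epsilon>" "\<epsilon> \<le> 1" and alg: "bandit_algorithm K T A"
        and dp: "differentially_private K T \<epsilon> A" and guarantee: "regret_guarantee K v u N T A"
      for N T \<epsilon> A
    proof -
      interpret bandit_run K T A by unfold_locales (rule alg)
      let ?\<Omega> = "PiE {..<T} (\<lambda>_. {..<K})"
      \<comment> \<open>Expected number of pulls of \<open>a\<close> under \<open>X\<close>. The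
        reward set contains the spike height to match \<open>expected_pulls_ge\<close>; it varies
        with \<open>a\<close>, but the weights do not depend on it.\<close>
      define E where "E a = (\<Sum>w\<in>?\<Omega>. action_weight (insert (M a) ((\<lambda>b. - \<delta> b) ` {..<K})) base w *
        real (pulls T a w))" for a
      have T_pos: "0 < real T" and NX: "N X \<le> T" using T by auto
      have T_arm: "N (Y a) \<le> T" "(4 / \<delta> a) ^ 8 < T" if "a < K" for a
      proof -
        have "N (Y a) \<le> (\<Sum>a<K. N (Y a))" and
          "nat \<lceil>(4 / \<delta> a) ^ 8\<rceil> \<le> (\<Sum>a<K. nat \<lceil>(4 / \<delta> a) ^ 8\<rceil>)"
          by (rule member_le_sum; use that in simp)+
        then have "N (Y a) \<le> T" "nat \<lceil>(4 / \<delta> a) ^ 8\<rceil> < T" using T by linarith+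
        then show "N (Y a) \<le> T" "(4 / \<delta> a) ^ 8 < T" by linarith+
      qed
      have regret_X: "regret K T A X = (\<Sum>a<K. \<delta> a * E a)"
      proof -
        have weight: "action_weight (insert (M a) ((\<lambda>b. - \<delta> b) ` {..<K})) base w =
          action_weight ((\<lambda>b. - \<delta> b) ` {..<K}) base w" if "w \<in> ?\<Omega>" for a w
          unfolding base_def using that by (simp add: action_weight_return_pmf)
        have "regret K T A X = (\<Sum>w\<in>?\<Omega>. action_weight ((\<lambda>b. - \<delta> b) ` {..<K}) base w *
            (\<Sum>t<T. gap K X (w t)))"
          unfolding X_def by (intro regret_eq_sum_gaps) (auto simp: base_def)
        also have "\<dots> = (\<Sum>w\<in>?\<Omega>. \<Sum>a<K. \<delta> a *
            (action_weight ((\<lambda>b. - \<delta> b) ` {..<K}) base w * real (pulls T a w)))"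
          by (intro sum.cong refl) (simp add: gap_X sum_count_pulls sum_distrib_left sum_distrib_right mult_ac)
        also have "\<dots> = (\<Sum>a<K. \<delta> a * E a)"
          unfolding E_def sum_distrib_left
          by (subst sum.swap) (intro sum.cong refl, simp add: weight)
        finally show ?thesis .
      qed
      have E_nonneg: "0 \<le> E a" for a
        unfolding E_def by (intro sum_nonneg mult_nonneg_nonneg action_weight_nonneg) simp
      have E_ge: "ln T / (32 * (\<beta> a * \<epsilon>)) \<le> E a" if a: "a < K" "0 < \<delta> a" for a
      proof -
        have be: "0 < \<beta> a * \<epsilon>" using spike[OF a] eps by simp
        \<comment> \<open>For \<epsilon> very small compared with the horizon, the logarithmic term
          may exceed \<open>T / 2\<close>, so both constraints on \<open>m\<close> are built into a
          minimum.\<close>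
        define m where "m = min (ln T / (16 * (\<beta> a * \<epsilon>))) (T / 2)"
        have "regret K T A (Y a) \<le> T powr (3/4)"
          using guarantee heavy_Y[OF a] T_arm(1)[OF a(1)] by (simp add: regret_guarantee_def)
        moreover have "2 * (\<beta> a * \<epsilon>) * m \<le> 2 * (\<beta> a * \<epsilon>) * (ln T / (16 * (\<beta> a * \<epsilon>)))"
          using be by (intro mult_left_mono) (auto simp: m_def)
        moreover have "- \<delta> b \<noteq> M a" if "b < K" for b
          using spike(1)[OF a] gap_nonneg[OF that] by linarith
        ultimately have "m / 2 \<le> E a"
          unfolding E_def base_def Y_def spiked_def
          using spike[OF a] be eps a gap_nonneg T_arm(2)[OF a(1)] dp
          by (intro expected_pulls_ge[where d = "\<delta> a" and \<beta> = "\<beta> a" and \<epsilon> = \<epsilon>])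
             (auto simp: m_def)
        \<comment> \<open>The guarantee on \<open>X\<close> itself bounds the pulls of a suboptimal
          arm. This excludes \<open>m = T / 2\<close>, so the minimum is the logarithmic term,
          uniformly in \<epsilon>.\<close>
        moreover have "E a < T / 4"
        proof -
          have "\<delta> a * E a \<le> regret K T A X"
            unfolding regret_X using a gap_nonneg E_nonneg
            by (intro member_le_sum mult_nonneg_nonneg) auto
          also have "\<dots> \<le> T powr (3/4)"
            using guarantee heavy_X NX by (simp add: regret_guarantee_def)
          also have "\<dots> < \<delta> a * (T / 4)"
          proof -
            have "4 / \<delta> a < T powr (1/8)"
              using a(2) T_arm(2)[OF a(1)] by (intro less_powr_eighth) auto
            also have "\<dots> \<le> T powr (1/4)"
              using T_pos by (intro powr_mono) auto
            finally have "T powr (3/4) * 1 < T powr (3/4) * (T powr (1/4) * (\<delta> a / 4))"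
              using a(2) T_pos by (intro mult_strict_left_mono) (auto simp: field_simps)
            also have "\<dots> = T powr (3/4 + 1/4) * (\<delta> a / 4)"
              by (simp only: powr_add mult.assoc)
            finally show ?thesis using T_pos by (simp add: mult_ac)
          qed
          finally show ?thesis using a(2) by simp
        qed
        ultimately have "m < T / 2" by linarith
        then have "m = ln T / (16 * (\<beta> a * \<epsilon>))" by (auto simp: m_def min_def split: if_splits)
        with \<open>m / 2 \<le> E a\<close> show ?thesis by simp
      qed
      have arm: "c * (ln T / \<epsilon>) * (1 / \<delta> a) powr (1 / v) \<le> \<delta> a * E a" if a: "a < K" "0 < \<delta> a" for a
      proof -
        have "M a = (3 * u / 8 * (1 / \<delta> a)) powr (1 / v)" by (simp add: M_def)
        also have "\<dots> = 64 * c * (1 / \<delta> a) powr (1 / v)"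
          using assms a(2) by (subst powr_mult) (auto simp: c_def)
        finally have "c * (ln T / \<epsilon>) * (1 / \<delta> a) powr (1 / v) = M a / 64 * (ln T / \<epsilon>)" by simp
        \<comment> \<open>Since \<open>\<delta> a / \<beta> a = M a / 2\<close>, the gap cancels and
          the regret due to arm \<open>a\<close> scales with the spike height.\<close>
        also have "\<dots> = \<delta> a * (ln T / (32 * (\<beta> a * \<epsilon>)))"
          using spike[OF a] a(2) eps by (simp add: \<beta>_def field_simps)
        also have "\<dots> \<le> \<delta> a * E a"
          using E_ge[OF a] a(2) by (intro mult_left_mono) auto
        finally show ?thesis .
      qed
      have "c * (ln T / \<epsilon> * (\<Sum>a | a < K \<and> 0 < \<delta> a. (1 / \<delta> a) powr (1 / v))) =
          (\<Sum>a | a < K \<and> 0 < \<delta> a. c * (ln T / \<epsilon>) * (1 / \<delta> a) powr (1 / v))"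
        by (simp add: sum_distrib_left mult_ac)
      also have "\<dots> \<le> (\<Sum>a | a < K \<and> 0 < \<delta> a. \<delta> a * E a)"
        by (intro sum_mono arm) auto
      also have "\<dots> \<le> regret K T A X"
        unfolding regret_X using gap_nonneg E_nonneg by (intro sum_mono2) auto
      finally show ?thesis unfolding gap_X .
    qed
    show ?thesis
    proof (intro exI[of _ X] conjI allI impI)
      fix a assume "a < K"
      then show "arm_mean X a \<le> 1/6" using mean_X gap_nonneg[of a] by simp
    next
      fix N
      show "\<exists>T0. \<forall>T\<ge>T0. \<forall>\<epsilon> A.
            0 < \<epsilon> \<and> \<epsilon> \<le> 1 \<and> bandit_algorithm K T A \<and> differentially_private K T \<epsilon> A \<and>
            regret_guarantee K v u N T A \<longrightarrow>
            regret K T A X \<ge>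
              c * (ln (real T) / \<epsilon> * (\<Sum>a | a < K \<and> gap K X a > 0. (1 / gap K X a) powr (1 / v)))"
        using lower[of N] by blast
    qed (use heavy_X gap_X in auto)
  qed
  ultimately show ?thesis by blast
qed

end
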